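(* Let $I\subseteq\mathbb{R}$ be an interval with interior $I^{\circ}$, let $f:I\to\mathbb{R}$ be differentiable on $I^{\circ}$, let $a,b\in I^{\circ}$ with $0\le a<b$, and suppose $f'\in L[a,b]$. Let $q>1$ and let $p$ be defined by $1/p+1/q=1$. Suppose $|f'|^{q}$ is convex on $[a,b]$ and $g:[a,b]\to\mathbb{R}$ is continuous and symmetric to $(a+b)/2$. Then: (i) for every $\alpha>0$, $$\left|\left(\frac{f(a)+f(b)}{2}\right)\left[J_{a+}^{\alpha}g(b)+J_{b-}^{\alpha}g(a)\right]-\left[J_{a+}^{\alpha}(fg)(b)+J_{b-}^{\alpha}(fg)(a)\right]\right|\le \frac{2^{1/p}\|g\|_{\infty}(b-a)^{\alpha+1}}{(\alpha p+1)^{1/p}\,\Gamma(\alpha+1)}\left(1-\frac{1}{2^{\alpha p}}\right)^{1/p}\left(\frac{|f'(a)|^{q}+|f'(b)|^{q}}{2}\right)^{1/q};$$ (ii) for every $0<\alpha\le 1$, $$\left|\left(\frac{f(a)+f(b)}{2}\right)\left[J_{a+}^{\alpha}g(b)+J_{b-}^{\alpha}g(a)\right]-\left[J_{a+}^{\alpha}(fg)(b)+J_{b-}^{\alpha}(fg)(a)\right]\right|\le \frac{\|g\|_{\infty}(b-a)^{\alpha+1}}{(\alpha p+1)^{1/p}\,\Gamma(\alpha+1)}\left(\frac{|f'(a)|^{q}+|f'(b)|^{q}}{2}\right)^{1/q}.$$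
   Context: $L[a,b]$ denotes the space of Lebesgue integrable functions on $[a,b]$. For $h\in L[a,b]$ and $\alpha>0$, the Riemann-Liouville fractional integrals of order $\alpha$ are $$J_{a+}^{\alpha}h(x)=\frac{1}{\Gamma(\alpha)}\int_a^x (x-t)^{\alpha-1}h(t)\,dt\quad (x>a),\qquad J_{b-}^{\alpha}h(x)=\frac{1}{\Gamma(\alpha)}\int_x^b (t-x)^{\alpha-1}h(t)\,dt\quad (x<b),$$ where $\Gamma(\alpha)=\int_0^\infty e^{-t}t^{\alpha-1}\,dt$. In particular $J_{a+}^{\alpha}h(b)=\frac{1}{\Gamma(\alpha)}\int_a^b (b-t)^{\alpha-1}h(t)\,dt$ and $J_{b-}^{\alpha}h(a)=\frac{1}{\Gamma(\alpha)}\int_a^b (t-a)^{\alpha-1}h(t)\,dt$. "$g$ is symmetric to $(a+b)/2$" means $g(a+b-x)=g(x)$ for all $x\in[a,b]$. $fg$ denotes the pointwise product on $[a,b]$, and $\|g\|_{\infty}=\sup_{x\in[a,b]}|g(x)|$. *)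

theory Defs
  imports "HOL-Analysis.Analysis"
begin

text \<open>
  In both integrands the kernel vanishes at the singular endpoint because \<^term>\<open>0 powr c = 0\<close>;
  a single point does not affect the Lebesgue integral, so closed intervals are used throughout.
\<close>

definition RL_left :: "real \<Rightarrow> real \<Rightarrow> (real \<Rightarrow> real) \<Rightarrow> real \<Rightarrow> real" where
  "RL_left \<alpha> a h x =
     1 / Gamma \<alpha> * (LINT t:{a..x}|lebesgue. (x - t) powr (\<alpha> - 1) * h t)"

definition RL_right :: "real \<Rightarrow> real \<Rightarrow> (real \<Rightarrow> real) \<Rightarrow> real \<Rightarrow> real" where
  "RL_right \<alpha> b h x =
     1 / Gamma \<alpha> * (LINT t:{x..b}|lebesgue. (t - x) powr (\<alpha> - 1) * h t)"

definition sup_norm_on :: "real set \<Rightarrow> (real \<Rightarrow> real) \<Rightarrow> real" where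
  "sup_norm_on S g = (SUP x\<in>S. \<bar>g x\<bar>)"

end

theory Submission
  imports Defs
begin

text \<open>
  Let \<open>P\<close> be the primitive of \<open>(b - s) powr (\<alpha> - 1) * g s\<close> vanishing at \<open>a\<close>, and
  \<open>K t = P (a + b - t) - P t\<close>. By the symmetry of \<open>g\<close>, the derivative of \<open>K\<close> is
  minus \<open>g\<close> times the sum of the two fractional kernels, so integrating \<open>(K * f)'\<close> shows
  that the quantity to be estimated is, up to sign, the integral of \<open>K * f'\<close> divided by
  \<open>Gamma \<alpha>\<close>. Moreover \<open>\<bar>K t\<bar>\<close> is at most the sup norm of \<open>g\<close> times
  \<open>\<bar>(b - t) powr \<alpha> - (t - a) powr \<alpha>\<bar> / \<alpha>\<close>. Hoelder's inequality, together with the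
  chord bound for the convex function \<open>\<bar>f'\<bar> powr q\<close>, reduces everything to the \<open>p\<close>-th
  power of the last difference: superadditivity of \<open>x powr p\<close> yields (i), and
  subadditivity of \<open>x powr \<alpha>\<close> for \<open>\<alpha> \<le> 1\<close> yields (ii).
\<close>

section \<open>Inequalities between real powers\<close>

text \<open>After splitting off one factor, \<open>z powr p = z * z powr (p - 1)\<close>, the
  remaining power is monotone and can be evaluated at \<open>x + y\<close> in both summands.\<close>

lemma powr_superadditive:
  fixes x y p :: real
  assumes "0 \<le> x" "0 \<le> y" "1 \<le> p"
  shows "x powr p + y powr p \<le> (x + y) powr p"
proof -
  have split: "z powr p = z * z powr (p - 1)" if "0 \<le> z" for z :: real
    using that powr_add[of z 1 "p - 1"] by (cases "z = 0") auto
  have "x powr p + y powr p = x * x powr (p - 1) + y * y powr (p - 1)"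
    using assms by (simp add: split)
  also have "\<dots> \<le> x * (x + y) powr (p - 1) + y * (x + y) powr (p - 1)"
    using assms by (intro add_mono mult_left_mono powr_mono2) auto
  also have "\<dots> = (x + y) powr p"
    using assms by (simp add: split algebra_simps)
  finally show ?thesis .
qed

text \<open>This is superadditivity for the exponent \<open>1 / r\<close>, applied to
  \<open>x powr r\<close> and \<open>y powr r\<close>.\<close>

lemma powr_subadditive:
  fixes x y r :: real
  assumes "0 \<le> x" "0 \<le> y" "0 < r" "r \<le> 1"
  shows "(x + y) powr r \<le> x powr r + y powr r"
proof -
  have "x + y = (x powr r) powr (1 / r) + (y powr r) powr (1 / r)"
    using assms by (simp add: powr_powr)
  also have "\<dots> \<le> (x powr r + y powr r) powr (1 / r)"
    using assms by (intro powr_superadditive) auto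
  finally have "(x + y) powr r \<le> ((x powr r + y powr r) powr (1 / r)) powr r"
    using assms by (intro powr_mono2) auto
  then show ?thesis
    using assms by (simp add: powr_powr)
qed

text \<open>For \<open>v \<le> u\<close>, superadditivity of the \<open>p\<close>-th power applies
  to the decomposition of \<open>u powr r\<close> into \<open>u powr r - v powr r\<close> and
  \<open>v powr r\<close>. The right side is chosen so that its \<open>p\<close>-th power has an
  elementary integral.\<close>

lemma abs_powr_diff_le_superadditive:
  fixes x y r p :: real
  assumes "0 \<le> x" "0 \<le> y" "0 < r" "1 \<le> p"
  shows "\<bar>x powr r - y powr r\<bar> \<le> \<bar>x powr (r * p) - y powr (r * p)\<bar> powr (1 / p)"
proof -
  have *: "u powr r - v powr r \<le> \<bar>u powr (r * p) - v powr (r * p)\<bar> powr (1 / p)"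
    if "0 \<le> v" "v \<le> u" for u v :: real
  proof -
    have le: "v powr r \<le> u powr r" using that assms by (intro powr_mono2) auto
    have "(u powr r - v powr r) powr p + (v powr r) powr p \<le> (u powr r) powr p"
      using powr_superadditive[of "u powr r - v powr r" "v powr r" p] le assms by simp
    then have "(u powr r - v powr r) powr p \<le> \<bar>u powr (r * p) - v powr (r * p)\<bar>"
      by (simp add: powr_powr)
    then have "((u powr r - v powr r) powr p) powr (1 / p)
        \<le> \<bar>u powr (r * p) - v powr (r * p)\<bar> powr (1 / p)"
      using assms by (intro powr_mono2) auto
    then show ?thesis using assms le by (simp add: powr_powr)
  qed
  show ?thesis
  proof (cases "y \<le> x")
    case True
    then have "y powr r \<le> x powr r" using assms by (intro powr_mono2) auto
    then show ?thesis using *[of y x] True assms by simp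
  next
    case False
    then have "x powr r \<le> y powr r" using assms by (intro powr_mono2) auto
    then show ?thesis using *[of x y] False assms by (simp add: abs_minus_commute)
  qed
qed

text \<open>Subadditivity is applied to the decomposition of the larger number into the difference
  and the smaller number.\<close>

lemma abs_powr_diff_le_subadditive:
  fixes x y r :: real
  assumes "0 \<le> x" "0 \<le> y" "0 < r" "r \<le> 1"
  shows "\<bar>x powr r - y powr r\<bar> \<le> \<bar>x - y\<bar> powr r"
proof -
  have *: "u powr r - v powr r \<le> (u - v) powr r" if "0 \<le> v" "v \<le> u" for u v :: real
    using powr_subadditive[of "u - v" v r] that assms by simp
  show ?thesis
  proof (cases "y \<le> x")
    case True
    then have "y powr r \<le> x powr r" using assms by (intro powr_mono2) auto
    then show ?thesis using *[of y x] True assms by simp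
  next
    case False
    then have "x powr r \<le> y powr r" using assms by (intro powr_mono2) auto
    then show ?thesis using *[of x y] False assms by simp
  qed
qed

section \<open>Hoelder's inequality\<close>

text \<open>Young's inequality holds pointwise for the normalised functions and is then integrated.
  The majorants \<open>U\<close> and \<open>V\<close> stand for the \<open>p\<close>-th and
  \<open>q\<close>-th powers of the two factors, so only their integrals have to be known.\<close>

lemma Holder_integral_bound:
  fixes U V w :: "real \<Rightarrow> real"
  assumes U: "(U has_integral A) S" and V: "(V has_integral B) S"
    and w: "w integrable_on S"
    and U0: "\<And>t. t \<in> S \<Longrightarrow> 0 \<le> U t" and V0: "\<And>t. t \<in> S \<Longrightarrow> 0 \<le> V t"
    and le: "\<And>t. t \<in> S \<Longrightarrow> \<bar>w t\<bar> \<le> c * (U t powr (1 / p) * V t powr (1 / q))"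
    and c: "0 \<le> c" and pq: "p > 1" "q > 1" "1 / p + 1 / q = 1"
  shows "\<bar>integral S w\<bar> \<le> c * (A powr (1 / p) * B powr (1 / q))"
proof -
  have A: "0 \<le> A" and B: "0 \<le> B"
    using has_integral_nonneg U U0 V V0 by blast+
  \<comment> \<open>The perturbation by \<open>e\<close> makes the normalisation in Young's inequality legitimate when \<open>A\<close> or \<open>B\<close> is zero.\<close>
  have eps: "\<bar>integral S w\<bar> \<le> c * ((A + e) powr (1 / p) * (B + e) powr (1 / q))"
    if e: "e > 0" for e
  proof -
    let ?C = "c * ((A + e) powr (1 / p) * (B + e) powr (1 / q))"
    let ?h = "\<lambda>t. ?C * (U t / (A + e) / p + V t / (B + e) / q)"
    have h: "(?h has_integral ?C * (A / (A + e) / p + B / (B + e) / q)) S"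
      by (intro has_integral_mult_right has_integral_add has_integral_divide U V)
    have "\<bar>w t\<bar> \<le> ?h t" if t: "t \<in> S" for t
    proof -
      let ?x = "(U t / (A + e)) powr (1 / p)" and ?y = "(V t / (B + e)) powr (1 / q)"
      have x: "(A + e) powr (1 / p) * ?x = U t powr (1 / p)"
        using A e U0[OF t] by (simp add: powr_divide)
      have y: "(B + e) powr (1 / q) * ?y = V t powr (1 / q)"
        using B e V0[OF t] by (simp add: powr_divide)
      have "?x * ?y \<le> ?x powr p / p + ?y powr q / q"
        using pq by (intro Youngs_inequality) auto
      also have "\<dots> = U t / (A + e) / p + V t / (B + e) / q"
        using A B e U0[OF t] V0[OF t] pq by (simp add: powr_powr)
      finally have "?C * (?x * ?y) \<le> ?h t"
        using c by (intro mult_left_mono) auto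
      moreover have "?C * (?x * ?y) = c * (U t powr (1 / p) * V t powr (1 / q))"
        unfolding x[symmetric] y[symmetric] by (simp add: mult_ac)
      ultimately show ?thesis using le[OF t] by linarith
    qed
    then have "\<bar>integral S w\<bar> \<le> integral S ?h"
      using integral_norm_bound_integral[OF w has_integral_integrable[OF h]] by simp
    also have "\<dots> = ?C * (A / (A + e) / p + B / (B + e) / q)"
      using h by (rule integral_unique)
    also have "\<dots> \<le> ?C * (1 / p + 1 / q)"
      using A B e pq c by (intro mult_left_mono add_mono divide_right_mono) auto
    finally show ?thesis using pq by simp
  qed
  \<comment> \<open>The limit \<open>e\<close> to 0 from the right is legitimate even if
    \<open>A\<close> or \<open>B\<close> vanishes, because the exponents are positive and the bases
    stay nonnegative.\<close>
  have "((\<lambda>e. c * ((A + e) powr (1 / p) * (B + e) powr (1 / q)))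
      \<longlongrightarrow> c * ((A + 0) powr (1 / p) * (B + 0) powr (1 / q))) (at_right 0)"
    using A B pq
    by (intro tendsto_intros tendsto_powr')
      (auto simp: eventually_at_right_less eventually_at_filter intro!: eventuallyI)
  then have "\<bar>integral S w\<bar> \<le> c * ((A + 0) powr (1 / p) * (B + 0) powr (1 / q))"
    by (rule tendsto_lowerbound)
      (auto intro: eventually_mono[OF eventually_at_right_less] eps)
  then show ?thesis by simp
qed

section \<open>Explicit integrals of powers\<close>

text \<open>For \<open>r > -1\<close> the primitive has the positive exponent \<open>r + 1\<close>,
  so it is continuous even where the base vanishes, and differentiability inside the interval
  suffices. The slopes \<open>-1\<close> and \<open>1\<close> give the two fractional
  kernels.\<close>

lemma has_integral_powr_affine:
  fixes u s r c d :: real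
  assumes "c \<le> d" "s \<noteq> 0" "r > -1" "0 \<le> u + s * c" "0 \<le> u + s * d"
  shows "((\<lambda>t. (u + s * t) powr r) has_integral
      ((u + s * d) powr (r + 1) - (u + s * c) powr (r + 1)) / (s * (r + 1))) {c..d}"
proof -
  have pos: "0 \<le> u + s * t" if "t \<in> {c..d}" for t
  proof (cases "s > 0")
    case True
    then have "s * c \<le> s * t" using that by simp
    then show ?thesis using assms by linarith
  next
    case False
    then have "s * d \<le> s * t" using that assms by simp
    then show ?thesis using assms by linarith
  qed
  have pos': "0 < u + s * t" if "t \<in> {c<..<d}" for t
  proof (cases "s > 0")
    case True
    then have "s * c < s * t" using that by simp
    then show ?thesis using assms by linarith
  next
    case False
    then have "s * d < s * t" using that assms by simp
    then show ?thesis using assms by linarith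
  qed
  have "((\<lambda>t. (u + s * t) powr r) has_integral
      (u + s * d) powr (r + 1) / (s * (r + 1)) - (u + s * c) powr (r + 1) / (s * (r + 1))) {c..d}"
  proof (rule fundamental_theorem_of_calculus_interior)
    show "continuous_on {c..d} (\<lambda>t. (u + s * t) powr (r + 1) / (s * (r + 1)))"
      using assms pos by (intro continuous_intros continuous_on_powr') auto
    fix t assume t: "t \<in> {c<..<d}"
    have "((\<lambda>t. u + s * t) has_real_derivative s) (at t)"
      by (auto intro!: derivative_eq_intros)
    from DERIV_fun_powr[OF this pos'[OF t], of "r + 1"]
    have "((\<lambda>t. (u + s * t) powr (r + 1) / (s * (r + 1))) has_real_derivative
        (r + 1) * (u + s * t) powr r * s / (s * (r + 1))) (at t)"
      by (intro DERIV_cdivide) simp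
    then show "((\<lambda>t. (u + s * t) powr (r + 1) / (s * (r + 1))) has_vector_derivative
        (u + s * t) powr r) (at t)"
      using assms by (simp add: has_real_derivative_iff_has_vector_derivative)
  qed (use assms in auto)
  then show ?thesis by (simp add: diff_divide_distrib)
qed

lemma has_integral_symmetric:
  fixes h :: "real \<Rightarrow> real"
  assumes "(h has_integral A) {a..(a + b) / 2}" "a \<le> b"
    and sym: "\<And>t. h (a + b - t) = h t"
  shows "(h has_integral 2 * A) {a..b}"
proof -
  \<comment> \<open>The reflection of \<open>t\<close> to \<open>a + b - t\<close> carries the left
    half onto the right half; it is performed as a negation followed by a translation.\<close>
  have "((\<lambda>t. h (- t)) has_integral A) {-((a + b) / 2)..-a}"
    using assms by simp
  then have "((\<lambda>t. h (- (t + - (a + b)))) has_integral A) {-((a + b) / 2) - - (a + b)..-a - - (a + b)}"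
    using has_integral_affinity'[of "\<lambda>t. h (- t)" A "-((a + b) / 2)" "-a" 1 "- (a + b)"] by simp
  moreover have "h (- (t + - (a + b))) = h t" for t
    using sym[of t] by (simp add: algebra_simps)
  ultimately have "(h has_integral A) {(a + b) / 2..b}"
    by (simp add: field_simps)
  from has_integral_combine[OF _ _ assms(1) this] show ?thesis
    using assms(2) by simp
qed

text \<open>The integrand is invariant under reflection at the midpoint, and on the left half
  \<open>t - a \<le> b - t\<close> removes the absolute value.\<close>

lemma has_integral_abs_powr_diff:
  fixes a b r :: real
  assumes "a < b" "0 < r"
  shows "((\<lambda>t. \<bar>(b - t) powr r - (t - a) powr r\<bar>) has_integral
      2 * ((b - a) powr (r + 1) / (r + 1) * (1 - 1 / 2 powr r))) {a..b}"
proof (rule has_integral_symmetric)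
  let ?m = "(a + b) / 2"
  have eqs: "b + -1 * ?m = (b - a) / 2" "-a + 1 * ?m = (b - a) / 2" "b + -1 * a = b - a" "-a + 1 * a = 0"
    by (simp_all add: field_simps)
  have "((\<lambda>t. (b + -1 * t) powr r - (-a + 1 * t) powr r) has_integral
      ((b + -1 * ?m) powr (r + 1) - (b + -1 * a) powr (r + 1)) / (-1 * (r + 1))
      - ((-a + 1 * ?m) powr (r + 1) - (-a + 1 * a) powr (r + 1)) / (1 * (r + 1))) {a..?m}"
    using assms by (intro has_integral_diff has_integral_powr_affine) (auto simp: field_simps)
  moreover have "((b + -1 * ?m) powr (r + 1) - (b + -1 * a) powr (r + 1)) / (-1 * (r + 1))
      - ((-a + 1 * ?m) powr (r + 1) - (-a + 1 * a) powr (r + 1)) / (1 * (r + 1))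
      = (b - a) powr (r + 1) / (r + 1) * (1 - 1 / 2 powr r)"
  proof -
    define x y where "x = (b - a) powr (r + 1)" and "y = ((b - a) / 2) powr (r + 1)"
    \<comment> \<open>Halving the base divides its power by \<open>2 powr (r + 1)\<close>, so
      \<open>y\<close> is \<open>x / 2 powr (r + 1)\<close>.\<close>
    have "x / 2 powr r = 2 * y"
      using assms by (simp add: x_def y_def powr_divide powr_add)
    then have "(x - x / 2 powr r) / (r + 1) = (x - 2 * y) / (r + 1)"
      by (simp only:)
    then have "x / (r + 1) * (1 - 1 / 2 powr r) = (x - 2 * y) / (r + 1)"
      by (simp add: right_diff_distrib diff_divide_distrib mult.commute)
    moreover have "(y - x) / (-1 * (r + 1)) - (y - 0 powr (r + 1)) / (1 * (r + 1)) = (x - 2 * y) / (r + 1)"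
      using assms by (simp add: divide_simps) (simp add: algebra_simps)
    ultimately show ?thesis
      unfolding eqs x_def y_def by (simp only:)
  qed
  ultimately have "((\<lambda>t. (b - t) powr r - (t - a) powr r) has_integral
      (b - a) powr (r + 1) / (r + 1) * (1 - 1 / 2 powr r)) {a..?m}"
    by simp
  then show "((\<lambda>t. \<bar>(b - t) powr r - (t - a) powr r\<bar>) has_integral
      (b - a) powr (r + 1) / (r + 1) * (1 - 1 / 2 powr r)) {a..?m}"
  proof (rule has_integral_eq[rotated])
    fix t assume "t \<in> {a..?m}"
    then have "(t - a) powr r \<le> (b - t) powr r"
      using assms by (intro powr_mono2) auto
    then show "(b - t) powr r - (t - a) powr r = \<bar>(b - t) powr r - (t - a) powr r\<bar>" by simp
  qed
qed (use assms in \<open>auto simp: abs_minus_commute\<close>)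

text \<open>On the left half the base is the affine function \<open>a + b - 2 * t\<close>, which
  decreases from \<open>b - a\<close> to 0; symmetry supplies the other half.\<close>

lemma has_integral_abs_midpoint_powr:
  fixes a b r :: real
  assumes "a < b" "0 < r"
  shows "((\<lambda>t. \<bar>(b - t) - (t - a)\<bar> powr r) has_integral (b - a) powr (r + 1) / (r + 1)) {a..b}"
proof -
  let ?m = "(a + b) / 2"
  have "((\<lambda>t. (a + b + -2 * t) powr r) has_integral
      ((a + b + -2 * ?m) powr (r + 1) - (a + b + -2 * a) powr (r + 1)) / (-2 * (r + 1))) {a..?m}"
    using assms by (intro has_integral_powr_affine) (auto simp: field_simps)
  moreover have "((a + b + -2 * ?m) powr (r + 1) - (a + b + -2 * a) powr (r + 1)) / (-2 * (r + 1))
      = (b - a) powr (r + 1) / (2 * (r + 1))"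
  proof -
    have "a + b + -2 * ?m = 0" "a + b + -2 * a = b - a" by (simp_all add: field_simps)
    then show ?thesis using assms by (simp add: divide_simps) (simp add: algebra_simps)
  qed
  ultimately have "((\<lambda>t. (a + b + -2 * t) powr r) has_integral
      (b - a) powr (r + 1) / (2 * (r + 1))) {a..?m}"
    by metis
  then have "((\<lambda>t. \<bar>(b - t) - (t - a)\<bar> powr r) has_integral
      (b - a) powr (r + 1) / (2 * (r + 1))) {a..?m}"
    by (rule has_integral_eq[rotated]) (auto simp: algebra_simps)
  then have "((\<lambda>t. \<bar>(b - t) - (t - a)\<bar> powr r) has_integral
      2 * ((b - a) powr (r + 1) / (2 * (r + 1)))) {a..b}"
    by (rule has_integral_symmetric) (use assms in \<open>auto simp: algebra_simps abs_minus_commute\<close>)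
  then show ?thesis by (simp only: times_divide_eq_right mult_divide_mult_cancel_left_if) simp
qed

section \<open>Integrability of the weighted kernels, and the chord majorant\<close>

text \<open>The kernel is nonnegative with a finite integral, and a continuous factor on a compact
  interval is bounded and measurable. Absolute integrability allows passing from the Lebesgue
  integrals in \<open>RL_left\<close> and \<open>RL_right\<close> to gauge integrals.\<close>

lemma absolutely_integrable_powr_affine_mult:
  fixes h :: "real \<Rightarrow> real"
  assumes "continuous_on {c..d} h" "c \<le> d" "s \<noteq> 0" "r > -1" "0 \<le> u + s * c" "0 \<le> u + s * d"
  shows "(\<lambda>t. (u + s * t) powr r * h t) absolutely_integrable_on {c..d}"
proof -
  have "(\<lambda>t. (u + s * t) powr r) absolutely_integrable_on {c..d}"
    using has_integral_powr_affine[of c d s r u] assms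
    by (intro nonnegative_absolutely_integrable_1) (auto simp: integrable_on_def)
  then have "(\<lambda>t. h t * (u + s * t) powr r) absolutely_integrable_on {c..d}"
    using assms
    by (intro absolutely_integrable_bounded_measurable_product_real
        continuous_imp_measurable_on_sets_lebesgue compact_imp_bounded compact_continuous_image) auto
  then show ?thesis by (simp add: mult.commute)
qed

text \<open>With \<phi> the \<open>q\<close>-th power of \<open>\<bar>f'\<bar>\<close>, the chord
  serves as the majorant \<open>V\<close> in Hoelder's inequality; its integral is explicit.\<close>

lemma convex_on_le_chord:
  fixes \<phi> :: "real \<Rightarrow> real"
  assumes "convex_on {a..b} \<phi>" "a < b" "t \<in> {a..b}"
  shows "\<phi> t \<le> ((b - t) * \<phi> a + (t - a) * \<phi> b) / (b - a)"
proof -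
  define l where "l = (t - a) / (b - a)"
  have l: "0 \<le> l" "l \<le> 1" "l * (b - a) = t - a"
    using assms by (auto simp: l_def)
  then have "\<phi> ((1 - l) *\<^sub>R a + l *\<^sub>R b) \<le> (1 - l) * \<phi> a + l * \<phi> b"
    using assms by (intro convex_onD) auto
  moreover have "(1 - l) *\<^sub>R a + l *\<^sub>R b = t"
    using l(3) by (simp add: algebra_simps)
  moreover have "1 - l = (b - t) / (b - a)"
    using assms by (simp add: l_def field_simps)
  ultimately show ?thesis by (simp add: l_def add_divide_distrib)
qed

lemma has_integral_chord:
  fixes a b A B :: real
  assumes "a < b"
  shows "((\<lambda>t. ((b - t) * A + (t - a) * B) / (b - a)) has_integral (b - a) * ((A + B) / 2)) {a..b}"
proof -
  let ?F = "\<lambda>t. - (b - t)\<^sup>2 / 2 * A + (t - a)\<^sup>2 / 2 * B"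
  have "((\<lambda>t. (b - t) * A + (t - a) * B) has_integral ?F b - ?F a) {a..b}"
    using assms
    by (intro fundamental_theorem_of_calculus)
      (auto intro!: derivative_eq_intros simp: field_simps
        simp flip: has_real_derivative_iff_has_vector_derivative)
  then have "((\<lambda>t. ((b - t) * A + (t - a) * B) / (b - a)) has_integral (?F b - ?F a) / (b - a)) {a..b}"
    by (rule has_integral_divide)
  moreover have "(?F b - ?F a) / (b - a) = (b - a) * ((A + B) / 2)"
    using assms by (simp add: field_simps power2_eq_square)
  ultimately show ?thesis by (simp only:)
qed

section \<open>The integral identity and the bound on its kernel\<close>

text \<open>The trapezoid term comes from the boundary values of \<open>K * f\<close>: since
  \<open>P a = 0\<close>, \<open>K\<close> equals \<open>P b\<close> at \<open>a\<close> and
  \<open>- P b\<close> at \<open>b\<close>, while \<open>P b\<close> is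
  \<open>Gamma \<alpha>\<close> times either fractional integral of \<open>g\<close>.\<close>

lemma fractional_trapezoid_identity:
  fixes f f' g :: "real \<Rightarrow> real" and a b \<alpha> :: real
  assumes ab: "a < b" and \<alpha>: "\<alpha> > 0"
    and f: "\<And>t. t \<in> {a..b} \<Longrightarrow> (f has_real_derivative f' t) (at t)"
    and g: "continuous_on {a..b} g" and sym: "\<And>t. t \<in> {a..b} \<Longrightarrow> g (a + b - t) = g t"
  defines "P \<equiv> \<lambda>x. integral {a..x} (\<lambda>s. (b - s) powr (\<alpha> - 1) * g s)"
  shows "((\<lambda>t. (P (a + b - t) - P t) * f' t) has_integral
      Gamma \<alpha> * (RL_left \<alpha> a (\<lambda>x. f x * g x) b + RL_right \<alpha> b (\<lambda>x. f x * g x) a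
        - (f a + f b) / 2 * (RL_left \<alpha> a g b + RL_right \<alpha> b g a))) {a..b}"
proof -
  let ?K = "\<lambda>t. P (a + b - t) - P t"
  let ?L = "\<lambda>t. (b - t) powr (\<alpha> - 1)" and ?R = "\<lambda>t. (t - a) powr (\<alpha> - 1)"
  have Gpos: "Gamma \<alpha> > 0" using \<alpha> by (rule Gamma_real_pos)
  have L: "(\<lambda>t. ?L t * h t) absolutely_integrable_on {a..b}"
    and R: "(\<lambda>t. ?R t * h t) absolutely_integrable_on {a..b}"
    if "continuous_on {a..b} h" for h
    using absolutely_integrable_powr_affine_mult[of a b h "-1" "\<alpha> - 1" b]
      absolutely_integrable_powr_affine_mult[of a b h 1 "\<alpha> - 1" "-a"] that ab \<alpha>
    by simp_all
  have RL_left: "Gamma \<alpha> * RL_left \<alpha> a h b = integral {a..b} (\<lambda>t. ?L t * h t)"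
    and RL_right: "Gamma \<alpha> * RL_right \<alpha> b h a = integral {a..b} (\<lambda>t. ?R t * h t)"
    if "continuous_on {a..b} h" for h
    using Gpos set_lebesgue_integral_eq_integral(2)[OF L[OF that]]
      set_lebesgue_integral_eq_integral(2)[OF R[OF that]]
    by (simp_all add: RL_left_def RL_right_def)
  have contf: "continuous_on {a..b} f"
    using f by (meson DERIV_isCont continuous_at_imp_continuous_on)
  then have fg: "continuous_on {a..b} (\<lambda>t. f t * g t)"
    using g by (intro continuous_intros)
  have Lg: "(\<lambda>t. ?L t * g t) integrable_on {a..b}"
    using L[OF g] by (rule absolutely_integrable_on_def[THEN iffD1, THEN conjunct1])
  have contP: "continuous_on {a..b} P"
    unfolding P_def using Lg by (rule indefinite_integral_continuous_1)
  have contP': "continuous_on {a..b} (\<lambda>t. P (a + b - t))"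
    by (rule continuous_on_compose2[OF contP]) (auto intro!: continuous_intros)
  \<comment> \<open>The kernel may be unbounded at \<open>b\<close>, so only interior points are
    treated; continuity of \<open>P\<close> on the closed interval takes care of the
    endpoints.\<close>
  have derP: "(P has_real_derivative ?L t * g t) (at t)" if t: "t \<in> {a<..<b}" for t
  proof -
    have "isCont g t"
      using g t by (metis continuous_on_interior interior_atLeastAtMost_real)
    moreover have "isCont ?L t"
      using t by (intro continuous_intros) auto
    ultimately have "isCont (\<lambda>t. ?L t * g t) t"
      by (rule isCont_mult[rotated])
    then have "continuous (at t within ({a..b} - {})) (\<lambda>t. ?L t * g t)"
      by (rule continuous_at_imp_continuous_at_within)
    with integral_has_vector_derivative_continuous_at[OF Lg, of t "{}"] t
    have "(P has_vector_derivative ?L t * g t) (at t within {a..b})"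
      unfolding P_def by simp
    moreover have "at t within {a..b} = at t"
      using t by (intro at_within_interior) simp
    ultimately show ?thesis
      by (simp add: has_real_derivative_iff_has_vector_derivative)
  qed
  \<comment> \<open>Reflection turns the left kernel into the right one, as
    \<open>b - (a + b - t) = t - a\<close>, and symmetry of \<open>g\<close> restores
    \<open>g t\<close>.\<close>
  have derP': "((\<lambda>t. P (a + b - t)) has_real_derivative - (?R t * g t)) (at t)"
    if t: "t \<in> {a<..<b}" for t
  proof -
    have "((\<lambda>t. a + b - t) has_real_derivative -1) (at t)"
      by (auto intro!: derivative_eq_intros)
    from DERIV_chain2[OF derP this] t sym[of t] show ?thesis by simp
  qed
  have Pa: "P a = 0" unfolding P_def by simp
  \<comment> \<open>Integrating the derivative of \<open>- P (a + b - t)\<close> shows that the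
    right kernel gives the same total \<open>P b\<close> as the left one.\<close>
  have "((\<lambda>t. ?R t * g t) has_integral - P (a + b - b) - - P (a + b - a)) {a..b}"
    using ab contP' derP'[THEN DERIV_minus]
    by (intro fundamental_theorem_of_calculus_interior)
      (auto simp: has_real_derivative_iff_has_vector_derivative intro!: continuous_intros)
  then have J: "Gamma \<alpha> * RL_left \<alpha> a g b = P b" "Gamma \<alpha> * RL_right \<alpha> b g a = P b"
    using RL_left[OF g] RL_right[OF g] Pa by (simp_all add: P_def integral_unique)
  have der: "((\<lambda>t. ?K t * f t) has_vector_derivative
      (?K t * f' t - (?R t * (f t * g t) + ?L t * (f t * g t)))) (at t)" if t: "t \<in> {a<..<b}" for t
    using DERIV_mult[OF DERIV_diff[OF derP'[OF t] derP[OF t]] f[of t]] t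
    by (simp add: has_real_derivative_iff_has_vector_derivative algebra_simps)
  have "((\<lambda>t. ?K t * f' t - (?R t * (f t * g t) + ?L t * (f t * g t))) has_integral
      ?K b * f b - ?K a * f a) {a..b}"
    using ab contP contP' contf der
    by (intro fundamental_theorem_of_calculus_interior) (auto intro!: continuous_intros)
  moreover have "((\<lambda>t. ?R t * (f t * g t) + ?L t * (f t * g t)) has_integral
      Gamma \<alpha> * RL_right \<alpha> b (\<lambda>x. f x * g x) a + Gamma \<alpha> * RL_left \<alpha> a (\<lambda>x. f x * g x) b) {a..b}"
    unfolding RL_left[OF fg] RL_right[OF fg]
    using L[OF fg] R[OF fg] by (intro has_integral_add integrable_integral)
      (auto simp: absolutely_integrable_on_def)
  ultimately have "((\<lambda>t. ?K t * f' t) has_integral ?K b * f b - ?K a * f a +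
      (Gamma \<alpha> * RL_right \<alpha> b (\<lambda>x. f x * g x) a + Gamma \<alpha> * RL_left \<alpha> a (\<lambda>x. f x * g x) b)) {a..b}"
    by (drule_tac has_integral_add) auto
  moreover have "?K b * f b - ?K a * f a
      = - ((f a + f b) / 2 * (Gamma \<alpha> * RL_left \<alpha> a g b + Gamma \<alpha> * RL_right \<alpha> b g a))"
    unfolding J using Pa by (simp add: algebra_simps)
  moreover have "- (c * (G * l + G * r)) + (G * r' + G * l') = G * (l' + r' - c * (l + r))"
    for c G l r l' r' :: real
    by (simp add: algebra_simps)
  ultimately show ?thesis by (simp only:)
qed

text \<open>The difference is the integral of the weighted kernel between \<open>t\<close> and its
  mirror image; bounding \<open>g\<close> by \<open>G\<close> leaves the explicit integral of a
  power.\<close>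

lemma fractional_kernel_bound:
  fixes g :: "real \<Rightarrow> real" and a b \<alpha> G :: real
  assumes ab: "a < b" and \<alpha>: "\<alpha> > 0" and g: "continuous_on {a..b} g"
    and G: "\<And>t. t \<in> {a..b} \<Longrightarrow> \<bar>g t\<bar> \<le> G" and t: "t \<in> {a..b}"
  defines "P \<equiv> \<lambda>x. integral {a..x} (\<lambda>s. (b - s) powr (\<alpha> - 1) * g s)"
  shows "\<bar>P (a + b - t) - P t\<bar> \<le> G / \<alpha> * \<bar>(b - t) powr \<alpha> - (t - a) powr \<alpha>\<bar>"
proof -
  let ?k = "\<lambda>s. (b - s) powr (\<alpha> - 1) * g s"
  have int: "?k integrable_on {a..b}"
    using absolutely_integrable_powr_affine_mult[of a b g "-1" "\<alpha> - 1" b] g ab \<alpha>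
    by (auto simp: absolutely_integrable_on_def)
  have *: "\<bar>P d - P c\<bar> \<le> G / \<alpha> * \<bar>(b - c) powr \<alpha> - (b - d) powr \<alpha>\<bar>"
    if cd: "a \<le> c" "c \<le> d" "d \<le> b" for c d
  proof -
    have "integral {a..c} ?k + integral {c..d} ?k = integral {a..d} ?k"
      using cd integrable_subinterval_real[OF int, of a d] by (intro Henstock_Kurzweil_Integration.integral_combine) auto
    then have "P d - P c = integral {c..d} ?k" by (simp add: P_def)
    moreover have "((\<lambda>s. (b - s) powr (\<alpha> - 1)) has_integral
        ((b - c) powr \<alpha> - (b - d) powr \<alpha>) / \<alpha>) {c..d}"
      using has_integral_powr_affine[of c d "-1" "\<alpha> - 1" b] cd \<alpha> by (simp add: minus_divide_left)
    then have "((\<lambda>s. (b - s) powr (\<alpha> - 1) * G) has_integral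
        ((b - c) powr \<alpha> - (b - d) powr \<alpha>) / \<alpha> * G) {c..d}"
      by (rule has_integral_mult_left)
    moreover have "?k integrable_on {c..d}"
      using cd integrable_subinterval_real[OF int, of c d] by auto
    moreover have "norm (?k s) \<le> (b - s) powr (\<alpha> - 1) * G" if "s \<in> {c..d}" for s
      using G[of s] that cd by (simp add: abs_mult mult_left_mono)
    ultimately have "norm (integral {c..d} ?k) \<le> ((b - c) powr \<alpha> - (b - d) powr \<alpha>) / \<alpha> * G"
      by (metis (no_types, lifting) integral_norm_bound_integral integral_unique has_integral_integrable)
    moreover have "(b - d) powr \<alpha> \<le> (b - c) powr \<alpha>"
      using cd \<alpha> by (intro powr_mono2) auto
    ultimately show ?thesis
      using \<open>P d - P c = integral {c..d} ?k\<close> by (simp add: mult.commute)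
  qed
  show ?thesis
  \<comment> \<open>The case decides which of \<open>t\<close> and \<open>a + b - t\<close> is the
    lower limit; their distances to \<open>b\<close> are \<open>b - t\<close> and
    \<open>t - a\<close>.\<close>
  proof (cases "t \<le> a + b - t")
    case True
    then show ?thesis using *[of t "a + b - t"] t by simp
  next
    case False
    then show ?thesis using *[of "a + b - t" t] t by (simp add: abs_minus_commute)
  qed
qed

section \<open>The common estimate and the two final bounds\<close>

text \<open>\<open>U\<close> is kept as a parameter because (i) and (ii) differ only in the majorant
  chosen for the \<open>p\<close>-th power of the kernel difference.\<close>

lemma fractional_trapezoid_bound:
  fixes f f' g U :: "real \<Rightarrow> real" and a b p q \<alpha> G :: real
  assumes ab: "a < b" and \<alpha>: "\<alpha> > 0" and pq: "p > 1" "q > 1" "1 / p + 1 / q = 1"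
    and f: "\<And>t. t \<in> {a..b} \<Longrightarrow> (f has_real_derivative f' t) (at t)"
    and conv: "convex_on {a..b} (\<lambda>x. \<bar>f' x\<bar> powr q)"
    and g: "continuous_on {a..b} g" and sym: "\<And>t. t \<in> {a..b} \<Longrightarrow> g (a + b - t) = g t"
    and G: "\<And>t. t \<in> {a..b} \<Longrightarrow> \<bar>g t\<bar> \<le> G"
    and U: "(U has_integral A) {a..b}" and U0: "\<And>t. t \<in> {a..b} \<Longrightarrow> 0 \<le> U t"
    and kU: "\<And>t. t \<in> {a..b} \<Longrightarrow> \<bar>(b - t) powr \<alpha> - (t - a) powr \<alpha>\<bar> \<le> U t powr (1 / p)"
  shows "\<bar>(f a + f b) / 2 * (RL_left \<alpha> a g b + RL_right \<alpha> b g a)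
         - (RL_left \<alpha> a (\<lambda>x. f x * g x) b + RL_right \<alpha> b (\<lambda>x. f x * g x) a)\<bar>
      \<le> G / Gamma (\<alpha> + 1) * (A powr (1 / p) * (b - a) powr (1 / q)
         * ((\<bar>f' a\<bar> powr q + \<bar>f' b\<bar> powr q) / 2) powr (1 / q))"
    (is "\<bar>?E\<bar> \<le> _")
proof -
  define P where "P x = integral {a..x} (\<lambda>s. (b - s) powr (\<alpha> - 1) * g s)" for x
  let ?w = "\<lambda>t. (P (a + b - t) - P t) * f' t"
  let ?V = "\<lambda>t. ((b - t) * \<bar>f' a\<bar> powr q + (t - a) * \<bar>f' b\<bar> powr q) / (b - a)"
  have Gpos: "Gamma \<alpha> > 0" using \<alpha> by (rule Gamma_real_pos)
  have G0: "0 \<le> G" using G[of a] ab by (meson abs_ge_zero atLeastAtMost_iff less_imp_le order_trans order_refl)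
  have w: "(?w has_integral Gamma \<alpha> * - ?E) {a..b}"
    using fractional_trapezoid_identity[OF ab \<alpha> f g sym] by (simp add: P_def)
  have "\<bar>integral {a..b} ?w\<bar> \<le> G / \<alpha> * (A powr (1 / p)
      * ((b - a) * ((\<bar>f' a\<bar> powr q + \<bar>f' b\<bar> powr q) / 2)) powr (1 / q))"
  proof (rule Holder_integral_bound[OF U has_integral_chord[OF ab] _ U0])
    show "?w integrable_on {a..b}" using w by (rule has_integral_integrable)
    fix t assume t: "t \<in> {a..b}"
    show "0 \<le> ?V t" using t ab by simp
    have "(\<bar>f' t\<bar> powr q) powr (1 / q) \<le> ?V t powr (1 / q)"
      using convex_on_le_chord[OF conv ab t] pq by (intro powr_mono2) auto
    then have V: "\<bar>f' t\<bar> \<le> ?V t powr (1 / q)" using pq by (simp add: powr_powr)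
    have "\<bar>P (a + b - t) - P t\<bar> \<le> G / \<alpha> * \<bar>(b - t) powr \<alpha> - (t - a) powr \<alpha>\<bar>"
      using fractional_kernel_bound[OF ab \<alpha> g G t] by (simp add: P_def)
    also have "\<dots> \<le> G / \<alpha> * U t powr (1 / p)"
      using kU[OF t] G0 \<alpha> by (intro mult_left_mono) auto
    finally have "\<bar>P (a + b - t) - P t\<bar> * \<bar>f' t\<bar> \<le> G / \<alpha> * U t powr (1 / p) * ?V t powr (1 / q)"
      using V G0 \<alpha> by (intro mult_mono) auto
    then show "\<bar>?w t\<bar> \<le> G / \<alpha> * (U t powr (1 / p) * ?V t powr (1 / q))"
      by (simp add: abs_mult mult.assoc)
  qed (use G0 \<alpha> pq in auto)
  then have "Gamma \<alpha> * \<bar>?E\<bar> \<le> G / \<alpha> * (A powr (1 / p) * (b - a) powr (1 / q)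
      * ((\<bar>f' a\<bar> powr q + \<bar>f' b\<bar> powr q) / 2) powr (1 / q))"
    unfolding integral_unique[OF w] using ab Gpos
    by (simp only: abs_mult abs_minus abs_of_pos powr_mult diff_ge_0_iff_ge less_imp_le mult.assoc)
  \<comment> \<open>This merges the factor \<alpha> from integrating the kernel with the
    \<open>Gamma \<alpha>\<close> from the fractional integrals.\<close>
  moreover have "Gamma (\<alpha> + 1) = \<alpha> * Gamma \<alpha>"
    using \<alpha> by (intro Gamma_plus1) (auto elim: nonpos_Ints_cases)
  moreover have "G / (\<alpha> * Gamma \<alpha>) * X = G / \<alpha> * X / Gamma \<alpha>" for X
    by simp
  ultimately show ?thesis
    using Gpos by (simp only: pos_le_divide_eq mult.commute[of _ "Gamma \<alpha>"])
qed

theorem theorem7: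
  fixes I :: "real set" and f g :: "real \<Rightarrow> real" and a b p q :: real
  assumes "is_interval I"
    and "\<forall>x\<in>interior I. f differentiable (at x)"
    and "a \<in> interior I" and "b \<in> interior I"
    and "0 \<le> a" and "a < b"
    and "deriv f absolutely_integrable_on {a..b}"
    and "q > 1" and "1 / p + 1 / q = 1"
    and "convex_on {a..b} (\<lambda>x. \<bar>deriv f x\<bar> powr q)"
    and "continuous_on {a..b} g"
    and "\<forall>x\<in>{a..b}. g (a + b - x) = g x"
  shows "(\<forall>\<alpha>>0.
      \<bar>(f a + f b) / 2 * (RL_left \<alpha> a g b + RL_right \<alpha> b g a)
         - (RL_left \<alpha> a (\<lambda>x. f x * g x) b + RL_right \<alpha> b (\<lambda>x. f x * g x) a)\<bar>
      \<le> 2 powr (1 / p) * sup_norm_on {a..b} g * (b - a) powr (\<alpha> + 1)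
           / ((\<alpha> * p + 1) powr (1 / p) * Gamma (\<alpha> + 1))
         * (1 - 1 / 2 powr (\<alpha> * p)) powr (1 / p)
         * ((\<bar>deriv f a\<bar> powr q + \<bar>deriv f b\<bar> powr q) / 2) powr (1 / q))
    \<and> (\<forall>\<alpha>. 0 < \<alpha> \<and> \<alpha> \<le> 1 \<longrightarrow>
      \<bar>(f a + f b) / 2 * (RL_left \<alpha> a g b + RL_right \<alpha> b g a)
         - (RL_left \<alpha> a (\<lambda>x. f x * g x) b + RL_right \<alpha> b (\<lambda>x. f x * g x) a)\<bar>
      \<le> sup_norm_on {a..b} g * (b - a) powr (\<alpha> + 1)
           / ((\<alpha> * p + 1) powr (1 / p) * Gamma (\<alpha> + 1))
         * ((\<bar>deriv f a\<bar> powr q + \<bar>deriv f b\<bar> powr q) / 2) powr (1 / q))"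
proof -
  let ?M = "((\<bar>deriv f a\<bar> powr q + \<bar>deriv f b\<bar> powr q) / 2) powr (1 / q)"
  let ?G = "sup_norm_on {a..b} g"
  have p_inv: "1 / p = 1 - 1 / q" "0 < 1 / q" using assms by auto
  moreover have "1 / q < 1" using assms by simp
  ultimately have "0 < 1 / p" "1 / p < 1" by linarith+
  then have p: "p > 1" by (metis zero_less_divide_1_iff divide_less_eq_1_pos)
  have "{a..b} \<subseteq> interior I"
    using assms(1,3,4)
    by (metis convex_contains_segment convex_interior is_interval_convex
        closed_segment_eq_real_ivl1 assms(6) less_imp_le)
  then have f: "(f has_real_derivative deriv f t) (at t)" if "t \<in> {a..b}" for t
    using assms that by (auto simp: DERIV_deriv_iff_real_differentiable)
  \<comment> \<open>Compactness makes the set of values bounded, so that the supremum in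
    \<open>sup_norm_on\<close> is a genuine upper bound.\<close>
  have "compact ((\<lambda>x. \<bar>g x\<bar>) ` {a..b})"
    using assms by (intro compact_continuous_image continuous_intros) auto
  then have "bdd_above ((\<lambda>x. \<bar>g x\<bar>) ` {a..b})"
    by (intro bounded_imp_bdd_above compact_imp_bounded)
  then have G: "\<bar>g t\<bar> \<le> ?G" if "t \<in> {a..b}" for t
    unfolding sup_norm_on_def using that by (rule cSUP_upper[rotated])
  note bound = fractional_trapezoid_bound[OF \<open>a < b\<close> _ p \<open>q > 1\<close> \<open>1 / p + 1 / q = 1\<close> f
      \<open>convex_on _ _\<close> \<open>continuous_on _ g\<close> _ G]
  \<comment> \<open>One power of \<open>b - a\<close> stems from the integral of \<open>U\<close>,
    the other from the chord; the exponents add up to \<open>\<alpha> + 1\<close> because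
    \<open>1 / p + 1 / q = 1\<close>.\<close>
  have pow: "((b - a) powr (\<alpha> * p + 1)) powr (1 / p) * (b - a) powr (1 / q) = (b - a) powr (\<alpha> + 1)" for \<alpha>
  proof -
    have "(\<alpha> * p + 1) * (1 / p) + 1 / q = \<alpha> + (1 / p + 1 / q)"
      using p by (simp add: field_simps)
    then show ?thesis
      using assms by (simp only: powr_powr flip: powr_add)
  qed
  show ?thesis
  proof (intro conjI allI impI)
    fix \<alpha> :: real assume \<alpha>: "\<alpha> > 0"
    let ?A = "2 * ((b - a) powr (\<alpha> * p + 1) / (\<alpha> * p + 1) * (1 - 1 / 2 powr (\<alpha> * p)))"
    \<comment> \<open>This makes the last factor of \<open>?A\<close> nonnegative, so the power
      \<open>1 / p\<close> distributes over the product.\<close>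
    have "1 \<le> 2 powr (\<alpha> * p)" using \<alpha> p by (intro ge_one_powr_ge_zero) auto
    then have "?A powr (1 / p) = 2 powr (1 / p) * (((b - a) powr (\<alpha> * p + 1)) powr (1 / p)
        / (\<alpha> * p + 1) powr (1 / p) * (1 - 1 / 2 powr (\<alpha> * p)) powr (1 / p))"
      using \<alpha> p by (simp add: powr_mult powr_divide)
    then have eq: "?G / Gamma (\<alpha> + 1) * (?A powr (1 / p) * (b - a) powr (1 / q) * ?M)
        = 2 powr (1 / p) * ?G * (((b - a) powr (\<alpha> * p + 1)) powr (1 / p) * (b - a) powr (1 / q))
           / ((\<alpha> * p + 1) powr (1 / p) * Gamma (\<alpha> + 1))
         * (1 - 1 / 2 powr (\<alpha> * p)) powr (1 / p) * ?M"
      by (simp add: mult_ac)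
    show "\<bar>(f a + f b) / 2 * (RL_left \<alpha> a g b + RL_right \<alpha> b g a)
         - (RL_left \<alpha> a (\<lambda>x. f x * g x) b + RL_right \<alpha> b (\<lambda>x. f x * g x) a)\<bar>
      \<le> 2 powr (1 / p) * ?G * (b - a) powr (\<alpha> + 1)
           / ((\<alpha> * p + 1) powr (1 / p) * Gamma (\<alpha> + 1))
         * (1 - 1 / 2 powr (\<alpha> * p)) powr (1 / p) * ?M"
      unfolding pow[of \<alpha>, symmetric] eq[symmetric]
    proof (rule bound[OF \<alpha>])
      \<comment> \<open>For (i), \<open>U\<close> is the difference of the powers with exponent
        \<open>\<alpha> * p\<close>, as superadditivity suggests.\<close>
      show "((\<lambda>t. \<bar>(b - t) powr (\<alpha> * p) - (t - a) powr (\<alpha> * p)\<bar>) has_integral ?A) {a..b}"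
        using \<alpha> p assms by (intro has_integral_abs_powr_diff) auto
    qed (use \<alpha> p assms in \<open>auto intro!: abs_powr_diff_le_superadditive\<close>)
  next
    fix \<alpha> :: real assume \<alpha>: "0 < \<alpha> \<and> \<alpha> \<le> 1"
    let ?A = "(b - a) powr (\<alpha> * p + 1) / (\<alpha> * p + 1)"
    have "?A powr (1 / p) = ((b - a) powr (\<alpha> * p + 1)) powr (1 / p) / (\<alpha> * p + 1) powr (1 / p)"
      using \<alpha> p by (simp add: powr_divide)
    then have eq: "?G / Gamma (\<alpha> + 1) * (?A powr (1 / p) * (b - a) powr (1 / q) * ?M)
        = ?G * (((b - a) powr (\<alpha> * p + 1)) powr (1 / p) * (b - a) powr (1 / q))
           / ((\<alpha> * p + 1) powr (1 / p) * Gamma (\<alpha> + 1)) * ?M"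
      by (simp add: mult_ac)
    show "\<bar>(f a + f b) / 2 * (RL_left \<alpha> a g b + RL_right \<alpha> b g a)
         - (RL_left \<alpha> a (\<lambda>x. f x * g x) b + RL_right \<alpha> b (\<lambda>x. f x * g x) a)\<bar>
      \<le> ?G * (b - a) powr (\<alpha> + 1) / ((\<alpha> * p + 1) powr (1 / p) * Gamma (\<alpha> + 1)) * ?M"
      unfolding pow[of \<alpha>, symmetric] eq[symmetric]
    proof (rule bound)
      \<comment> \<open>For (ii), \<open>U\<close> is a power of the difference of the bases, which
        subadditivity permits for \<open>\<alpha> \<le> 1\<close>.\<close>
      show "((\<lambda>t. \<bar>(b - t) - (t - a)\<bar> powr (\<alpha> * p)) has_integral ?A) {a..b}"
        using \<alpha> p assms by (intro has_integral_abs_midpoint_powr) auto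
      show "\<bar>(b - t) powr \<alpha> - (t - a) powr \<alpha>\<bar> \<le> (\<bar>(b - t) - (t - a)\<bar> powr (\<alpha> * p)) powr (1 / p)"
        if "t \<in> {a..b}" for t
        using abs_powr_diff_le_subadditive[of "b - t" "t - a" \<alpha>] that \<alpha> p by (simp add: powr_powr)
    qed (use \<alpha> assms in auto)
  qed
qed

end
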